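(* Let $k\ge 2$, $t\ge 1$, $q\ge 1$ be integers with $\gcd(k,q)=1$, and let $N=k^tq$. Then the length of every cycle in the shuffling poset for $N$ and $k$ (i.e. when $N$ is divided into $k$ equal stacks for shuffling) is a divisor of $\operatorname{order}_k(N-q)$. Further, there is a cycle of length $\operatorname{order}_k(N-q)$ in the shuffling poset.
   Context: $\operatorname{order}_k(s)$ denotes the multiplicative order of $k$ modulo $s$, i.e. the least positive integer $M$ with $k^M\equiv 1 \pmod s$ (equal to $1$ if $s=1$). Write $N=kn$, so $n=k^{t-1}q$. For $\ell\in\{0,1,\ldots,n-1\}$ the $\ell$-th column is the set of subscripts $\{\ell,\ell+n,\ldots,\ell+(k-1)n\}$ and the $\ell$-th block is the set of subscripts $\{k\ell,k\ell+1,\ldots,k\ell+(k-1)\}$. A shuffling weight function is a map $\varphi:\{0,\ldots,N-1\}\to\mathbb{Z}$ such that for all $\ell\in\{0,1,\ldots,n-1\}$: (i) $\{\varphi(\ell),\varphi(\ell+n),\ldots,\varphi(\ell+(k-1)n)\}=\{\varphi(k\ell),\varphi(k\ell+1),\ldots,\varphi(k\ell+(k-1))\}$; and (ii) $\varphi(k\ell)<\varphi(k\ell+1)<\cdots<\varphi(k\ell+(k-1))$. A shuffling weight function $\varphi$ determines a bijection $\pi$ of $\{0,\ldots,N-1\}$: each subscript $x$ in the $\ell$-th column is sent to the unique subscript $\pi(x)$ in the $\ell$-th block with $\varphi(\pi(x))=\varphi(x)$. The cycles in the shuffling poset are the cycles of the permutation $\pi$ (a fixed point being a cycle of length $1$).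 Here the weight function used is $\varphi(A)=A_0+\cdots+A_{t-1}$, where $\ldots A_tA_{t-1}\ldots A_1A_0$ is the base $k$ expansion of $A$; this is a shuffling weight function when $\gcd(q,k)=1$. *)

theory Defs
  imports "HOL-Number_Theory.Number_Theory" "HOL-Combinatorics.Combinatorics"
begin

text \<open>Throughout, \<open>k\<close> is the number of stacks and \<open>N\<close>, a multiple of \<open>k\<close>, the number of subscripts,
  so that columns and blocks are indexed by \<open>l < n\<close> with \<open>n = N div k\<close>.\<close>

definition shuffle_column :: "nat \<Rightarrow> nat \<Rightarrow> nat \<Rightarrow> nat set" where
  "shuffle_column k N l = (\<lambda>j. l + j * (N div k)) ` {..<k}"

definition shuffle_block :: "nat \<Rightarrow> nat \<Rightarrow> nat set" where
  "shuffle_block k l = {k * l..<k * l + k}"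

text \<open>Only the values of \<open>\<phi>\<close> on \<open>{..<N}\<close> matter.\<close>

definition shuffling_weight :: "nat \<Rightarrow> nat \<Rightarrow> (nat \<Rightarrow> int) \<Rightarrow> bool" where
  "shuffling_weight k N \<phi> \<longleftrightarrow>
     (\<forall>l<N div k. \<phi> ` shuffle_column k N l = \<phi> ` shuffle_block k l \<and>
                  strict_mono_on (shuffle_block k l) \<phi>)"

text \<open>A subscript \<open>x < N\<close> lies in the column with index \<open>x mod (N div k)\<close>.  Outside \<open>{..<N}\<close> the map is
  the identity, as required by \<open>permutes\<close>.\<close>

definition shuffle_perm :: "nat \<Rightarrow> nat \<Rightarrow> (nat \<Rightarrow> int) \<Rightarrow> nat \<Rightarrow> nat" where
  "shuffle_perm k N \<phi> x =
     (if x < N then THE y. y \<in> shuffle_block k (x mod (N div k)) \<and> \<phi> y = \<phi> x else x)"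

text \<open>A cycle is represented by its set of elements, so its length is its cardinality.\<close>

definition shuffle_cycles :: "nat \<Rightarrow> nat \<Rightarrow> (nat \<Rightarrow> int) \<Rightarrow> nat set set" where
  "shuffle_cycles k N \<phi> = orbit (shuffle_perm k N \<phi>) ` {..<N}"

definition digit_weight :: "nat \<Rightarrow> nat \<Rightarrow> nat \<Rightarrow> int" where
  "digit_weight k t A = (\<Sum>i<t. int (A div k ^ i mod k))"


lemma shuffle_perm_unique:
  assumes "k dvd N" "shuffling_weight k N \<phi>" "x < N"
  shows "\<exists>!y. y \<in> shuffle_block k (x mod (N div k)) \<and> \<phi> y = \<phi> x"
proof -
  define n where "n = N div k"
  define l where "l = x mod n"
  have N: "N = k * n" using assms(1) by (simp add: n_def)
  with assms(3) have pos: "0 < n" "0 < k" by (auto intro: gr0I)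
  have ln: "l < n" using pos by (simp add: l_def)
  have "x div n < k" using assms(3) pos N by (simp add: less_mult_imp_div_less)
  moreover have "x = l + x div n * n" by (simp add: l_def)
  ultimately have "x \<in> shuffle_column k N l"
    unfolding shuffle_column_def n_def[symmetric] by blast
  with assms(2) ln have ex: "\<phi> x \<in> \<phi> ` shuffle_block k l"
    and sm: "strict_mono_on (shuffle_block k l) \<phi>"
    by (auto simp: shuffling_weight_def n_def)
  from sm have "inj_on \<phi> (shuffle_block k l)" by (rule strict_mono_on_imp_inj_on)
  with ex show ?thesis unfolding n_def[symmetric] l_def[symmetric]
    by (auto simp: inj_on_def)
qed

lemma shuffle_perm_mem:
  assumes "k dvd N" "shuffling_weight k N \<phi>" "x < N"
  shows "shuffle_perm k N \<phi> x \<in> shuffle_block k (x mod (N div k))"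
    and "\<phi> (shuffle_perm k N \<phi> x) = \<phi> x"
  using theI'[OF shuffle_perm_unique[OF assms]] assms(3) by (auto simp: shuffle_perm_def)

lemma shuffle_perm_permutes:
  assumes "k dvd N" "shuffling_weight k N \<phi>"
  shows "shuffle_perm k N \<phi> permutes {..<N}"
proof (cases "N = 0")
  case True
  then show ?thesis by (simp add: shuffle_perm_def permutes_def)
next
  case False
  define n where "n = N div k"
  define p where "p = shuffle_perm k N \<phi>"
  have N: "N = k * n" using assms(1) by (simp add: n_def)
  with False have pos: "0 < n" "0 < k" by (auto intro: gr0I)
  have mem: "p x \<in> shuffle_block k (x mod n)" "\<phi> (p x) = \<phi> x" if "x < N" for x
    using shuffle_perm_mem[OF assms that] by (simp_all add: p_def n_def)
  have div: "p x div k = x mod n" if "x < N" for x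
    using mem(1)[OF that] pos
    by (auto simp: shuffle_block_def intro!: div_nat_eqI)
  have col: "x \<in> shuffle_column k N (x mod n)" if "x < N" for x
  proof -
    have "x div n < k" using that pos N by (simp add: less_mult_imp_div_less)
    moreover have "x = x mod n + x div n * n" by simp
    ultimately show ?thesis unfolding shuffle_column_def n_def[symmetric] by blast
  qed
  have inj_col: "inj_on \<phi> (shuffle_column k N l)" if "l < n" for l
  proof (rule eq_card_imp_inj_on)
    show "finite (shuffle_column k N l)" by (simp add: shuffle_column_def)
    have "inj_on \<phi> (shuffle_block k l)" "\<phi> ` shuffle_column k N l = \<phi> ` shuffle_block k l"
      using assms(2) that
      by (auto simp: shuffling_weight_def n_def intro: strict_mono_on_imp_inj_on)
    then have "card (\<phi> ` shuffle_column k N l) = k"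
      by (simp add: card_image shuffle_block_def)
    moreover have "card (shuffle_column k N l) = k"
      using pos by (simp add: shuffle_column_def n_def[symmetric] card_image inj_on_def)
    ultimately show "card (\<phi> ` shuffle_column k N l) = card (shuffle_column k N l)" by simp
  qed
  have inj: "inj_on p {..<N}"
  proof (rule inj_onI)
    fix x y assume xy: "x \<in> {..<N}" "y \<in> {..<N}" "p x = p y"
    then have "x mod n = y mod n" "\<phi> x = \<phi> y" using div mem(2) by (metis lessThan_iff)+
    moreover have "x mod n < n" using pos by simp
    ultimately show "x = y" using inj_col col xy by (metis inj_onD lessThan_iff)
  qed
  have "p ` {..<N} \<subseteq> {..<N}"
  proof (rule image_subsetI)
    fix x assume "x \<in> {..<N}"
    then have "p x div k < n" using div pos by simp
    then have "p x < n * k" using pos by (simp add: div_less_iff_less_mult)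
    then show "p x \<in> {..<N}" by (simp add: N mult.commute)
  qed
  with inj have "bij_betw p {..<N} {..<N}"
    by (simp add: bij_betw_def endo_inj_surj)
  then show ?thesis unfolding p_def[symmetric]
    by (rule bij_imp_permutes) (simp add: p_def shuffle_perm_def)
qed

lemma shuffling_weight_digit_weight:
  assumes "k \<ge> 2" "t \<ge> 1" "q \<ge> 1" "coprime k q"
  shows "shuffling_weight k (k ^ t * q) (digit_weight k t)"
proof -
  define m where "m = t - 1"
  have t: "t = Suc m" using assms(2) by (simp add: m_def)
  have k: "k > 0" using assms(1) by simp
  have n: "k ^ t * q div k = k ^ m * q" using k by (simp add: t)
  have block: "digit_weight k t (k * l + j) = int j + digit_weight k m l" if "j < k" for l j
  proof -
    have "(k * l + j) div k ^ Suc i = l div k ^ i" for i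
      using that k by (simp add: div_mult2_eq)
    then show ?thesis using that unfolding digit_weight_def t sum.lessThan_Suc_shift
      by simp
  qed
  have column: "digit_weight k t (l + j * (k ^ m * q))
      = int ((l div k ^ m + j * q) mod k) + digit_weight k m l" for l j
  proof -
    have "(l + j * (k ^ m * q)) div k ^ i mod k = l div k ^ i mod k" if im: "i < m" for i
    proof -
      obtain d where d: "m = Suc (i + d)" using less_imp_Suc_add[OF im] by blast
      have "l + j * (k ^ m * q) = l + (k * (k ^ d * j * q)) * k ^ i"
        by (simp add: d power_add mult_ac)
      then have "(l + j * (k ^ m * q)) div k ^ i = l div k ^ i + k * (k ^ d * j * q)"
        using k by (metis add.commute div_mult_self1 less_numeral_extra(3) zero_less_power)
      then show ?thesis by simp
    qed
    moreover have "(l + j * (k ^ m * q)) div k ^ m = l div k ^ m + j * q"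
    proof -
      have "l + j * (k ^ m * q) = l + (j * q) * k ^ m" by (simp add: mult_ac)
      then show ?thesis using k
        by (metis add.commute div_mult_self1 less_numeral_extra(3) zero_less_power)
    qed
    ultimately show ?thesis by (simp add: digit_weight_def t)
  qed
  have bij: "(\<lambda>j. (a + j * q) mod k) ` {..<k} = {..<k}" for a
  proof (rule endo_inj_surj)
    show "(\<lambda>j. (a + j * q) mod k) ` {..<k} \<subseteq> {..<k}" using k by auto
    show "inj_on (\<lambda>j. (a + j * q) mod k) {..<k}"
    proof (rule inj_onI)
      fix i j assume ij: "i \<in> {..<k}" "j \<in> {..<k}" "(a + i * q) mod k = (a + j * q) mod k"
      then have "[a + i * q = a + j * q] (mod k)" by (simp add: cong_def)
      then have "[i * q = j * q] (mod k)" by (simp add: cong_add_lcancel_nat)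
      then have "[i = j] (mod k)"
        using assms(4) by (simp add: cong_mult_rcancel_nat coprime_commute)
      then show "i = j" using ij by (simp add: cong_def)
    qed
  qed simp
  show ?thesis unfolding shuffling_weight_def n
  proof (intro allI impI conjI)
    fix l
    have bl: "shuffle_block k l = (\<lambda>j. k * l + j) ` {..<k}"
      by (simp add: shuffle_block_def image_add_atLeastLessThan lessThan_atLeast0 add.commute)
    have "digit_weight k t ` shuffle_column k (k ^ t * q) l
        = (\<lambda>j. int j + digit_weight k m l) ` (\<lambda>j. (l div k ^ m + j * q) mod k) ` {..<k}"
      by (simp add: shuffle_column_def n image_image column)
    also have "\<dots> = digit_weight k t ` shuffle_block k l"
      unfolding bij bl image_image by (intro image_cong refl) (simp add: block)
    finally show "digit_weight k t ` shuffle_column k (k ^ t * q) l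
        = digit_weight k t ` shuffle_block k l" .
    show "strict_mono_on (shuffle_block k l) (digit_weight k t)"
      unfolding bl by (rule strict_mono_onI) (auto simp: block)
  qed
qed

end

theory Submission
  imports Defs
begin

text \<open>
  Write \<open>K = k ^ t\<close>, so that \<open>N = K * q\<close> and \<open>N - q = (K - 1) * q\<close>.  The permutation \<open>\<pi>\<close> acts on a
  subscript \<open>x\<close> by \<open>\<pi> x = k * (x mod (N div k)) + d\<close>, where \<open>d\<close> is the \<open>k ^ (t - 1)\<close>-digit of \<open>x\<close>:
  the digits of \<open>x\<close> below \<open>d\<close> are also the low digits of the column index, hence contribute equally to
  both sides of \<open>\<phi> (\<pi> x) = \<phi> x\<close>, and what remains is the last digit of \<open>\<pi> x\<close> against \<open>d\<close>.

  By the Chinese remainder theorem \<open>x\<close> is determined by \<open>x mod K\<close> and \<open>x mod q\<close>.  On the first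
  component \<open>\<pi>\<close> rotates the \<open>t\<close> low digits, that is, \<open>a\<close> becomes \<open>k * a - d * (K - 1)\<close>; on the second
  \<open>b\<close> becomes \<open>k * b + d\<close>.  The digit \<open>d\<close> cancels in \<open>a + (K - 1) * b\<close>, so this combination, which is
  well defined modulo \<open>(K - 1) * q = N - q\<close>, is simply multiplied by \<open>k\<close>: the nonlinear map \<open>\<pi>\<close>
  becomes linear (lemma \<open>linear_residue_step\<close>).

  The combination separates subscripts except that it cannot tell the low parts \<open>0\<close> and \<open>K - 1\<close>
  apart (lemma \<open>linear_residue_inject\<close>).  Digit rotation fixes both of these, so they never meet inside
  one cycle, and \<open>\<pi> ^^ M\<close> fixes \<open>x\<close> if and only if multiplication by \<open>k ^ M\<close> fixes the residue of \<open>x\<close>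
  modulo \<open>N - q\<close> (lemma \<open>shuffle_funpow_fixes_iff\<close>).  All cycle lengths
  therefore divide the order of \<open>k\<close>, and the order itself is the length of the cycle of any subscript
  whose residue is a unit.  The subscript \<open>1\<close> has residue \<open>K\<close>, which is one.
\<close>

section \<open>Cycle lengths\<close>

lemma card_orbit_eq_least_power:
  assumes "permutation p"
  shows "card (orbit p x) = least_power p x"
proof -
  have "orbit p x = {(p ^^ i) x | i. i < least_power p x}"
    using least_power_of_permutation[OF assms] by (rule orbit_altdef_bounded)
  also have "\<dots> = set (support p x)" by auto
  also have "card \<dots> = length (support p x)"
    using cycle_of_permutation[OF assms] by (rule distinct_card)
  finally show ?thesis by simp
qed

lemma card_orbit_dvd_iff:
  assumes "permutation p"
  shows "card (orbit p x) dvd m \<longleftrightarrow> (p ^^ m) x = x"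
  by (simp add: card_orbit_eq_least_power least_power_dvd assms)

section \<open>An explicit formula for the shuffle permutation\<close>

lemma digit_weight_append_digit:
  assumes "j < k"
  shows "digit_weight k (Suc m) (k * l + j) = int j + digit_weight k m l"
proof -
  have "(k * l + j) div k ^ Suc i = l div k ^ i" for i
    using assms by (simp add: div_mult2_eq)
  then show ?thesis
    using assms unfolding digit_weight_def sum.lessThan_Suc_shift by simp
qed

lemma digit_weight_add_high:
  "digit_weight k m (a + k ^ m * c) = digit_weight k m a"
proof (cases "k = 0")
  case True
  then show ?thesis by (cases m) (simp_all add: digit_weight_def)
next
  case False
  have "(a + k ^ m * c) div k ^ i mod k = a div k ^ i mod k" if "i < m" for i
  proof -
    obtain d where "m = Suc (i + d)" using less_imp_Suc_add \<open>i < m\<close> by blast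
    then have "a + k ^ m * c = a + k ^ i * (k * (k ^ d * c))"
      by (simp add: power_add mult_ac)
    then have "(a + k ^ m * c) div k ^ i = a div k ^ i + k * (k ^ d * c)"
      using False by (simp only: div_mult_self2 power_not_zero add.commute simp_thms)
    then show ?thesis by simp
  qed
  then show ?thesis by (simp add: digit_weight_def)
qed

lemma digit_weight_mod:
  "digit_weight k m (x mod (k ^ m * q)) = digit_weight k m x"
proof -
  have "digit_weight k m (x mod (k ^ m * q) + k ^ m * (q * (x div (k ^ m * q))))
      = digit_weight k m (x mod (k ^ m * q))"
    by (rule digit_weight_add_high)
  moreover have "x mod (k ^ m * q) + k ^ m * (q * (x div (k ^ m * q))) = x"
    unfolding mult.assoc[symmetric] by (rule mod_mult_div_eq)
  ultimately show ?thesis by simp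
qed

text \<open>Since \<open>\<pi> x\<close> lies in the block of \<open>x mod n\<close>, only its last digit is unknown; the digits of \<open>x\<close>
  of index less than \<open>m\<close> survive in \<open>x mod n\<close>, so equality of weights forces that last digit.\<close>

lemma shuffle_perm_digit_weight:
  assumes "k \<ge> 2" "q \<ge> 1" "coprime k q" "x < k ^ Suc m * q"
  shows "shuffle_perm k (k ^ Suc m * q) (digit_weight k (Suc m)) x
    = k * (x mod (k ^ m * q)) + x div k ^ m mod k"
proof -
  define N where "N = k ^ Suc m * q"
  define l where "l = x mod (k ^ m * q)"
  define y where "y = shuffle_perm k N (digit_weight k (Suc m)) x"
  have n: "N div k = k ^ m * q" using assms(1) by (simp add: N_def)
  have sw: "shuffling_weight k N (digit_weight k (Suc m))"
    using assms unfolding N_def by (intro shuffling_weight_digit_weight) auto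
  have kN: "k dvd N" and xN: "x < N" using assms(4) by (simp_all add: N_def)
  have "y \<in> shuffle_block k l" and w: "digit_weight k (Suc m) y = digit_weight k (Suc m) x"
    using shuffle_perm_mem[OF kN sw xN] by (simp_all add: y_def n l_def)
  then obtain j where j: "j < k" "y = k * l + j"
    by (auto simp: shuffle_block_def dest: le_Suc_ex)
  have "int j + digit_weight k m l = digit_weight k (Suc m) x"
    using w j by (simp add: digit_weight_append_digit)
  also have "\<dots> = int (x div k ^ m mod k) + digit_weight k m l"
    unfolding l_def digit_weight_mod by (simp add: digit_weight_def)
  finally show ?thesis using j by (simp add: y_def l_def N_def)
qed

section \<open>Linearisation modulo \<open>N - q\<close>\<close>

text \<open>The left-hand side is the digit rotation: \<open>d\<close> leaves the top of the window of \<open>m + 1\<close> low digits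
  and comes back at the bottom.  It is written as an equation rather than a congruence because the
  residue \<open>K - 1\<close> of the exceptional low part has to be told apart from \<open>0\<close>.\<close>

lemma shuffle_step_low_digits:
  fixes k m q x :: nat
  assumes "k > 0"
  defines "K \<equiv> k ^ Suc m" and "d \<equiv> x div k ^ m mod k"
  shows "(k * (x mod (k ^ m * q)) + d) mod K + d * (K - 1) = k * (x mod K)"
proof -
  define r where "r = x mod k ^ m"
  have xK: "x mod K = k ^ m * d + r"
    unfolding K_def d_def r_def power_Suc2 by (rule mod_mult2_eq)
  have "d < k" "r < k ^ m" using assms(1) by (simp_all add: d_def r_def)
  have "k * r + d < k * Suc r" using \<open>d < k\<close> by simp
  also have "\<dots> \<le> K" unfolding K_def power_Suc
    using \<open>r < k ^ m\<close> by (intro mult_le_mono2) simp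
  finally have lt: "k * r + d < K" .
  have "[k * (x mod (k ^ m * q)) = k * r] (mod K)"
    unfolding K_def power_Suc
    by (rule cong_cmult_leftI) (simp add: cong_def r_def mod_mult_right_eq mod_mod_cancel)
  then have "[k * (x mod (k ^ m * q)) + d = k * r + d] (mod K)"
    by (simp add: cong_add_rcancel_nat)
  then have "(k * (x mod (k ^ m * q)) + d) mod K = k * r + d"
    using lt by (simp add: cong_def)
  moreover have "d + d * (K - 1) = d * K"
    using lt by (cases K) simp_all
  moreover have "k * (x mod K) = d * K + k * r"
    unfolding xK by (simp add: K_def algebra_simps)
  ultimately show ?thesis by linarith
qed

lemma shuffle_step_mod_q:
  "[k * (x mod (c * q)) + d = k * x + d] (mod q)" for k x c q d :: nat
  by (intro cong_add cong_mult cong_refl) (simp add: cong_def mod_mod_cancel)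

text \<open>The summand \<open>(K - 1) * x\<close> stands for \<open>(K - 1) * (x mod q)\<close>, to which it is congruent modulo
  \<open>(K - 1) * q\<close>, the only modulus of interest.\<close>

definition linear_residue :: "nat \<Rightarrow> nat \<Rightarrow> nat" where
  "linear_residue K x = x mod K + (K - 1) * x"

text \<open>The two hypotheses are the effect of a shuffle step modulo \<open>K\<close> and modulo \<open>q\<close>.  The factor
  \<open>K - 1\<close> lifts the congruence modulo \<open>q\<close> to one modulo \<open>(K - 1) * q\<close>, where the digit \<open>d\<close> cancels.\<close>

lemma linear_residue_step:
  assumes low: "y mod K + d * (K - 1) = k * (x mod K)"
    and "[y = k * x + d] (mod q)"
  shows "[linear_residue K y = k * linear_residue K x] (mod (K - 1) * q)"
proof -
  have "[(K - 1) * y = (K - 1) * (k * x + d)] (mod (K - 1) * q)"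
    using assms(2) by (rule cong_cmult_leftI)
  then have "[y mod K + (K - 1) * y = y mod K + (K - 1) * (k * x + d)] (mod (K - 1) * q)"
    by (rule cong_add[OF cong_refl])
  also have "y mod K + (K - 1) * (k * x + d) = (y mod K + d * (K - 1)) + k * ((K - 1) * x)"
    by (simp add: algebra_simps)
  also have "\<dots> = k * linear_residue K x"
    unfolding low linear_residue_def by (simp add: algebra_simps)
  finally show ?thesis by (simp add: linear_residue_def)
qed

text \<open>The rotation of \<open>t\<close> equal digits \<open>0\<close> or \<open>k - 1\<close> does nothing.\<close>

lemma low_digits_step_fixes_extremes:
  fixes a' K a d k :: nat
  assumes "a' + d * (K - 1) = k * a" "a' < K" "d < k"
  shows "a = 0 \<Longrightarrow> a' = 0" and "a = K - 1 \<Longrightarrow> a' = K - 1"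
proof -
  show "a = 0 \<Longrightarrow> a' = 0" using assms by simp
  assume a: "a = K - 1"
  have "Suc d * (K - 1) \<le> k * (K - 1)" using assms(3) by (intro mult_le_mono1) simp
  then have "K - 1 \<le> a'" using assms(1) a by simp
  then show "a' = K - 1" using assms(2) by simp
qed

text \<open>Once the two extreme low parts are kept apart, the residue modulo \<open>(K - 1) * q\<close> recovers the low
  part from its value modulo \<open>K - 1\<close>, then the class modulo \<open>q\<close>, and hence the number.\<close>

lemma linear_residue_inject:
  assumes "K > 1" "coprime K q" "x < K * q" "y < K * q"
    and res: "[linear_residue K y = linear_residue K x] (mod (K - 1) * q)"
    and extremes: "x mod K = 0 \<Longrightarrow> y mod K = 0" "x mod K = K - 1 \<Longrightarrow> y mod K = K - 1"
  shows "y = x"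
proof -
  define a b where "a = x mod K" and "b = y mod K"
  have "a < K" "b < K" using assms(1) by (simp_all add: a_def b_def)
  have "[linear_residue K y = linear_residue K x] (mod (K - 1))"
    using res by (rule cong_modulus_mult_nat)
  then have ab: "[b = a] (mod (K - 1))"
    by (simp add: linear_residue_def a_def b_def cong_def)
  have "b = a"
  proof (cases "a = 0 \<or> a = K - 1")
    case True
    then show ?thesis using extremes by (auto simp: a_def b_def)
  next
    case False
    then have "a < K - 1" using \<open>a < K\<close> by linarith
    moreover from this have "b \<noteq> K - 1" using ab False by (auto simp: cong_def)
    ultimately show ?thesis using ab \<open>b < K\<close> by (simp add: cong_def)
  qed
  then have "[(K - 1) * y = (K - 1) * x] (mod (K - 1) * q)"
    using res by (simp add: linear_residue_def a_def b_def cong_add_lcancel_nat)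
  then have "[y = x] (mod q)"
    using assms(1) by (simp add: cong_def flip: mult_mod_right)
  moreover have "[y = x] (mod K)" using \<open>b = a\<close> by (simp add: a_def b_def cong_def)
  ultimately have "[y = x] (mod K * q)" using assms(2) by (intro coprime_cong_mult_nat)
  then show ?thesis using assms(3,4) by (simp add: cong_def)
qed

section \<open>Iterating the shuffle\<close>

lemma shuffle_funpow_fixes_iff:
  assumes "k \<ge> 2" "t \<ge> 1" "q \<ge> 1" "coprime k q" "N = k ^ t * q" "x < N"
  shows "(shuffle_perm k N (digit_weight k t) ^^ M) x = x \<longleftrightarrow>
    [k ^ M * linear_residue (k ^ t) x = linear_residue (k ^ t) x] (mod N - q)"
proof -
  define K where "K = k ^ t"
  define p where "p = shuffle_perm k N (digit_weight k t)"
  obtain m where m: "t = Suc m" using assms(2) by (cases t) auto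
  have N: "N = K * q" by (simp add: assms(5) K_def)
  have s: "N - q = (K - 1) * q" by (simp add: N diff_mult_distrib)
  have K1: "K > 1" unfolding K_def using assms(1,2) by (intro one_less_power) auto
  have copK: "coprime K q" using assms(4) by (simp add: K_def)
  have perm: "p permutes {..<N}"
    unfolding p_def assms(5) using assms(1-4)
    by (intro shuffle_perm_permutes shuffling_weight_digit_weight) (auto simp: m)

  have step: "\<exists>d<k. p y mod K + d * (K - 1) = k * (y mod K) \<and> [p y = k * y + d] (mod q)"
    if "y < N" for y
  proof (intro exI conjI)
    let ?d = "y div k ^ m mod k"
    have py: "p y = k * (y mod (k ^ m * q)) + ?d"
      using assms that shuffle_perm_digit_weight[of k q y m] by (simp add: p_def m)
    show "?d < k" using assms(1) by simp
    show "p y mod K + ?d * (K - 1) = k * (y mod K)"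
      unfolding py K_def m using assms(1) by (intro shuffle_step_low_digits) simp
    show "[p y = k * y + ?d] (mod q)" unfolding py by (rule shuffle_step_mod_q)
  qed

  have iter: "(p ^^ M) x < N
      \<and> [linear_residue K ((p ^^ M) x) = k ^ M * linear_residue K x] (mod N - q)
      \<and> (x mod K = 0 \<longrightarrow> (p ^^ M) x mod K = 0)
      \<and> (x mod K = K - 1 \<longrightarrow> (p ^^ M) x mod K = K - 1)"
  proof (induction M)
    case 0
    then show ?case using assms(6) by simp
  next
    case (Suc M)
    define y where "y = (p ^^ M) x"
    have y: "y < N" using Suc.IH by (simp add: y_def)
    obtain d where d: "d < k" "p y mod K + d * (K - 1) = k * (y mod K)"
        "[p y = k * y + d] (mod q)"
      using step[OF y] by blast
    have "p y < N" using permutes_in_image[OF perm] y by simp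
    moreover have "[linear_residue K (p y) = k ^ Suc M * linear_residue K x] (mod N - q)"
    proof -
      have "[linear_residue K (p y) = k * linear_residue K y] (mod N - q)"
        unfolding s using d(2,3) by (rule linear_residue_step)
      also have "[k * linear_residue K y = k * (k ^ M * linear_residue K x)] (mod N - q)"
        using Suc.IH by (intro cong_mult cong_refl) (simp add: y_def)
      finally show ?thesis by (simp add: mult.assoc)
    qed
    moreover have "p y mod K < K" using K1 by simp
    note low_digits_step_fixes_extremes[OF d(2) this d(1)]
    ultimately show ?case using Suc.IH by (simp add: y_def)
  qed

  have linear: "[linear_residue K ((p ^^ M) x) = k ^ M * linear_residue K x] (mod N - q)"
    using iter by blast
  show ?thesis unfolding p_def[symmetric] K_def[symmetric]
  proof
    assume "(p ^^ M) x = x"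
    with linear show "[k ^ M * linear_residue K x = linear_residue K x] (mod N - q)"
      by (simp only: cong_sym)
  next
    assume "[k ^ M * linear_residue K x = linear_residue K x] (mod N - q)"
    with linear have res: "[linear_residue K ((p ^^ M) x) = linear_residue K x] (mod (K - 1) * q)"
      unfolding s by (rule cong_trans)
    have bounds: "x < K * q" "(p ^^ M) x < K * q" using assms(6) iter by (simp_all only: N)
    show "(p ^^ M) x = x"
      by (rule linear_residue_inject[OF K1 copK bounds res]) (simp_all add: iter)
  qed
qed

theorem theorem3:
  fixes k t q N :: nat
  assumes "k \<ge> 2" and "t \<ge> 1" and "q \<ge> 1" and "gcd k q = 1"
    and "N = k ^ t * q"
  shows "(\<forall>C \<in> shuffle_cycles k N (digit_weight k t). card C dvd ord (N - q) k) \<and>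
         (\<exists>C \<in> shuffle_cycles k N (digit_weight k t). card C = ord (N - q) k)"
proof -
  define p where "p = shuffle_perm k N (digit_weight k t)"
  define M where "M = ord (N - q) k"
  have cop: "coprime k q" using assms(4) by (rule iffD2[OF coprime_iff_gcd_eq_1])
  have Kgt: "k ^ t > 1" using assms(1,2) by (intro one_less_power) auto
  have "k ^ t * 1 \<le> N" unfolding assms(5) using assms(3) by (rule mult_le_mono2)
  then have N1: "1 < N" using Kgt by linarith
  have s: "N - q = (k ^ t - 1) * q" by (simp add: assms(5) diff_mult_distrib)
  have "p permutes {..<N}"
    unfolding p_def assms(5) using assms(1-3) cop
    by (intro shuffle_perm_permutes shuffling_weight_digit_weight) auto
  then have "permutation p" by (rule permutes_imp_permutation[OF finite_lessThan])
  then have dvd_iff: "card (orbit p x) dvd i \<longleftrightarrow>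
      [k ^ i * linear_residue (k ^ t) x = linear_residue (k ^ t) x] (mod N - q)"
    if "x < N" for x i
    unfolding card_orbit_dvd_iff[OF \<open>permutation p\<close>] unfolding p_def using that cop assms
    by (intro shuffle_funpow_fixes_iff) auto

  have all: "card (orbit p x) dvd M" if "x < N" for x
  proof -
    have "[k ^ M = 1] (mod N - q)" unfolding M_def ord_divides by (rule dvd_refl)
    from cong_mult[OF this cong_refl, of "linear_residue (k ^ t) x"] show ?thesis
      unfolding dvd_iff[OF that] by simp
  qed

  \<comment> \<open>The residue of \<open>1\<close> is \<open>1 + (K - 1) = K\<close>, a power of \<open>k\<close>, hence it can be cancelled.\<close>
  have "card (orbit p 1) = M"
  proof (rule dvd_antisym)
    show "card (orbit p 1) dvd M" using N1 by (rule all)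
    have K: "linear_residue (k ^ t) 1 = k ^ t"
      unfolding linear_residue_def mod_less[OF Kgt] using Kgt by linarith
    have "coprime (k ^ t) (k ^ t - 1)"
      by (rule coprime_diff_one_right_nat[OF less_trans[OF zero_less_one Kgt]])
    then have "coprime (k ^ t) (N - q)"
      unfolding s coprime_mult_right_iff using cop by simp
    moreover have "[k ^ card (orbit p 1) * k ^ t = 1 * k ^ t] (mod N - q)"
      using dvd_iff[OF N1, of "card (orbit p 1)"] K by simp
    ultimately have "[k ^ card (orbit p 1) = 1] (mod N - q)"
      using cong_mult_rcancel_nat by blast
    then show "M dvd card (orbit p 1)" unfolding M_def ord_divides .
  qed
  with all N1 show ?thesis by (auto simp: shuffle_cycles_def p_def M_def)
qed

end
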